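(* For every integer $n\geq 0$ the Chebyshev polynomials of the first kind $T_m$ and of the second kind $U_m$ are given by $$T_{2n}(x)=(-1)^n+\sum_{j=1}^{n}(-1)^{n+j}\,2^{2j-1}\,p^{[2j]}_{n-j}\,x^{2j},\qquad T_{2n+1}(x)=\sum_{j=0}^{n}(-1)^{n+j}\,2^{2j}\,p^{[2j+1]}_{n-j}\,x^{2j+1},$$ $$U_{2n}(x)=\sum_{j=0}^{n}(-1)^{n+j}\,2^{2j}\binom{n+j}{2j}x^{2j},\qquad U_{2n+1}(x)=\sum_{j=0}^{n}(-1)^{n+j}\,2^{2j+1}\binom{n+j+1}{2j+1}x^{2j+1}.$$
   Context: The Chebyshev polynomials are defined by $T_0(x)=1$, $T_1(x)=x$, $T_n(x)=2xT_{n-1}(x)-T_{n-2}(x)$ for $n\geq 2$, and $U_0(x)=1$, $U_1(x)=2x$, $U_n(x)=2xU_{n-1}(x)-U_{n-2}(x)$ for $n\geq 2$. For an integer $i\geq 1$ the $i$-dimensional pyramidal numbers $(p^{[i]}_j)_{j\geq 0}$ are defined by the generating function $\sum_{j\geq 0}p^{[i]}_j t^j=\frac{1+t}{(1-t)^{i+1}}$, i.e. $p^{[i]}_j=2\binom{i+j}{j}-\binom{i+j-1}{j}$. *)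

theory Defs
  imports "HOL-Computational_Algebra.Computational_Algebra"
begin

fun cheb_T :: "nat \<Rightarrow> 'a::comm_ring_1 poly" where
  "cheb_T 0 = 1"
| "cheb_T (Suc 0) = [:0, 1:]"
| "cheb_T (Suc (Suc n)) = 2 * [:0, 1:] * cheb_T (Suc n) - cheb_T n"

fun cheb_U :: "nat \<Rightarrow> 'a::comm_ring_1 poly" where
  "cheb_U 0 = 1"
| "cheb_U (Suc 0) = 2 * [:0, 1:]"
| "cheb_U (Suc (Suc n)) = 2 * [:0, 1:] * cheb_U (Suc n) - cheb_U n"

text \<open>
  The coefficients of \<open>(1 + t) / (1 - t) ^ (i + 1)\<close>. Working with integer power series, where
  the library has no division, the inverse of the denominator is written
  \<open>fps_right_inverse _ 1\<close>; its second argument is the inverse of the constant term.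
\<close>

definition pyramidal :: "nat \<Rightarrow> nat \<Rightarrow> int" where
  "pyramidal i j = fps_nth ((1 + fps_X) * fps_right_inverse ((1 - fps_X) ^ (i + 1)) 1) j"

lemma pyramidal_generating_function:
  "Abs_fps (pyramidal i) * (1 - fps_X) ^ (i + 1) = 1 + fps_X"
proof -
  have "((1 - fps_X) ^ (i + 1) :: int fps) $ 0 * 1 = 1"
    by (simp add: fps_nth_power_0)
  then have "(1 - fps_X) ^ (i + 1) * fps_right_inverse ((1 - fps_X) ^ (i + 1)) 1 = (1 :: int fps)"
    by (rule fps_right_inverse)
  then have inv: "fps_right_inverse ((1 - fps_X) ^ (i + 1)) 1 * (1 - fps_X) ^ (i + 1) = (1 :: int fps)"
    by (simp only: mult.commute)
  have "Abs_fps (pyramidal i) = (1 + fps_X) * fps_right_inverse ((1 - fps_X) ^ (i + 1)) 1"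
    by (rule fps_ext) (simp add: pyramidal_def)
  then show ?thesis
    by (simp only: mult.assoc inv mult_1_right)
qed

lemma pyramidal_closed_form:
  assumes "i \<ge> 1"
  shows "pyramidal i j = 2 * int ((i + j) choose j) - int ((i + j - 1) choose j)"
proof -
  define G :: "nat \<Rightarrow> int fps" where "G k = Abs_fps (\<lambda>j. int ((k + j) choose j))" for k
  have step: "(1 - fps_X) * G (Suc k) = G k" for k
  proof (rule fps_ext)
    fix m show "((1 - fps_X) * G (Suc k)) $ m = G k $ m"
      by (cases m) (auto simp: G_def left_diff_distrib)
  qed
  have G: "(1 - fps_X) ^ (k + 1) * G k = 1" for k
  proof (induction k)
    case 0
    show ?case
    proof (rule fps_ext)
      fix m show "((1 - fps_X) ^ (0 + 1) * G 0) $ m = (1 :: int fps) $ m"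
        by (cases m) (auto simp: G_def left_diff_distrib)
    qed
  next
    case (Suc k)
    have "(1 - fps_X) ^ (Suc k + 1) * G (Suc k) = (1 - fps_X) ^ (k + 1) * ((1 - fps_X) * G (Suc k))"
      by (simp add: mult_ac)
    then show ?case by (simp only: step Suc)
  qed
  have "Abs_fps (pyramidal i) = Abs_fps (pyramidal i) * ((1 - fps_X) ^ (i + 1) * G i)"
    by (simp only: G mult_1_right)
  also have "\<dots> = (1 + fps_X) * G i"
    by (simp only: mult.assoc[symmetric] pyramidal_generating_function)
  finally have "pyramidal i j = ((1 + fps_X) * G i) $ j"
    by (simp only: fps_eq_iff fps_nth_Abs_fps)
  then show ?thesis
    using assms by (cases j) (auto simp: G_def distrib_right)
qed

end

theory Submission
  imports Defs
begin

text \<open>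
  The two kinds are linked by \<open>T\<^sub>n\<^sub>+\<^sub>1 = U\<^sub>n\<^sub>+\<^sub>1 - x U\<^sub>n\<close> (\<open>cheb_T_Suc_eq_cheb_U\<close>), so it is enough
  to know the coefficients of \<open>U\<^sub>n\<close>. Comparing coefficients of \<open>x\<^sup>k\<close> in the recurrence for \<open>U\<^sub>n\<close>
  gives, up to signs and powers of \<open>2\<close>, Pascal's rule; hence the coefficient of \<open>x\<^sup>k\<close> in \<open>U\<^sub>n\<close> with
  \<open>n + k = 2 m\<close> is \<open>(-1)\<^sup>m\<^sup>+\<^sup>k 2\<^sup>k (m choose k)\<close> (\<open>coeff_cheb_U\<close>). For \<open>n = k + 2 i\<close> with \<open>k \<ge> 1\<close> the link
  turns this into \<open>(-1)\<^sup>i 2\<^sup>k\<^sup>-\<^sup>1 (2 (k + i choose i) - (k + i - 1 choose i))\<close> for the coefficient of \<open>x\<^sup>k\<close>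
  in \<open>T\<^sub>n\<close>, and the bracket is the closed form of the pyramidal number with indices \<open>k\<close> and \<open>i\<close>
  (\<open>coeff_cheb_T\<close>). As \<open>k = 0\<close> is outside this formula, the constant term of \<open>T\<^sub>2\<^sub>n\<close> is treated
  separately. Both polynomials have degree at most \<open>n\<close> and the parity of \<open>n\<close>, so each is the sum of the
  corresponding monomials.
\<close>

section \<open>Recurrences\<close>

lemma coeff_two_X_mult:
  fixes p :: "'a::comm_ring_1 poly"
  shows "coeff (2 * [:0, 1:] * p) k = (case k of 0 \<Rightarrow> 0 | Suc l \<Rightarrow> 2 * coeff p l)"
proof -
  have X: "[:0, 1:] * q = pCons 0 q" for q :: "'a poly"
    by simp
  have "2 * [:0, 1:] * p = [:0, 1:] * (p + p)"
    by (simp only: mult_2 distrib_left distrib_right)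
  also have "\<dots> = pCons 0 (p + p)"
    by (rule X)
  finally have "2 * [:0, 1:] * p = pCons 0 (p + p)" .
  then show ?thesis
    by (cases k) (simp_all only: coeff_pCons coeff_add mult_2 nat.case)
qed

text \<open>
  Unlike \<open>2 T\<^sub>n = U\<^sub>n - U\<^sub>n\<^sub>-\<^sub>2\<close>, this relation determines \<open>T\<^sub>n\<close> also over rings in which \<open>2\<close> is not
  cancellable.
\<close>

lemma cheb_T_Suc_eq_cheb_U:
  "cheb_T (Suc n) = cheb_U (Suc n) - [:0, 1:] * (cheb_U n :: 'a::comm_ring_1 poly)"
proof (induction n rule: cheb_U.induct)
  case (3 n)
  have "cheb_T (Suc (Suc (Suc n))) = 2 * [:0, 1:] * cheb_T (Suc (Suc n)) - (cheb_T (Suc n) :: 'a poly)"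
    by (rule cheb_T.simps)
  also have "\<dots> = 2 * [:0, 1:] * (cheb_U (Suc (Suc n)) - [:0, 1:] * cheb_U (Suc n))
      - (cheb_U (Suc n) - [:0, 1:] * cheb_U n)"
    by (simp only: 3)
  also have "\<dots> = (2 * [:0, 1:] * cheb_U (Suc (Suc n)) - cheb_U (Suc n))
      - [:0, 1:] * (2 * [:0, 1:] * cheb_U (Suc n) - cheb_U n)"
    by (simp only: algebra_simps)
  also have "\<dots> = cheb_U (Suc (Suc (Suc n))) - [:0, 1:] * cheb_U (Suc (Suc n))"
    by (simp only: cheb_U.simps)
  finally show ?case .
qed (simp_all add: numeral_poly one_pCons)


section \<open>Coefficients of Chebyshev polynomials\<close>

lemma coeff_cheb_U_nonzeroD:
  "coeff (cheb_U n :: 'a::comm_ring_1 poly) k \<noteq> 0 \<Longrightarrow> k \<le> n \<and> even (n + k)"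
proof (induction n arbitrary: k rule: cheb_U.induct)
  case 1
  then show ?case by (cases k) (auto simp: one_pCons coeff_pCons)
next
  case 2
  then show ?case
    using coeff_two_X_mult[of "1 :: 'a poly" k]
    by (cases k) (auto simp: coeff_1 of_bool_def split: if_splits)
next
  case (3 n)
  from 3(3) have "(case k of 0 \<Rightarrow> 0 | Suc l \<Rightarrow> 2 * coeff (cheb_U (Suc n) :: 'a poly) l) \<noteq> 0
      \<or> coeff (cheb_U n :: 'a poly) k \<noteq> 0"
    by (auto simp only: cheb_U.simps coeff_diff coeff_two_X_mult diff_0_right)
  then show ?case
  proof
    assume "(case k of 0 \<Rightarrow> 0 | Suc l \<Rightarrow> 2 * coeff (cheb_U (Suc n) :: 'a poly) l) \<noteq> 0"
    then obtain l where "k = Suc l" "2 * coeff (cheb_U (Suc n) :: 'a poly) l \<noteq> 0"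
      by (cases k) simp_all
    then have "k = Suc l" "coeff (cheb_U (Suc n) :: 'a poly) l \<noteq> 0"
      by auto
    with 3(1)[of l] show ?thesis by auto
  next
    assume "coeff (cheb_U n :: 'a poly) k \<noteq> 0"
    with 3(2)[of k] show ?thesis by auto
  qed
qed

lemma coeff_cheb_T_nonzeroD:
  assumes "coeff (cheb_T n :: 'a::comm_ring_1 poly) k \<noteq> 0"
  shows "k \<le> n \<and> even (n + k)"
proof (cases n)
  case 0
  with assms show ?thesis by (auto simp: coeff_1 split: if_splits)
next
  case (Suc m)
  then consider "coeff (cheb_U n :: 'a poly) k \<noteq> 0"
    | l where "k = Suc l" "coeff (cheb_U m :: 'a poly) l \<noteq> 0"
    using assms by (cases k; cases "coeff (cheb_U n :: 'a poly) k = 0")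
      (auto simp: cheb_T_Suc_eq_cheb_U simp del: cheb_T.simps cheb_U.simps)
  then show ?thesis
    using Suc by cases (auto dest: coeff_cheb_U_nonzeroD)
qed

text \<open>
  The hypothesis does not bound \<open>k\<close> by \<open>n\<close>: for \<open>k > n\<close> the binomial coefficient vanishes. The
  induction therefore needs no special treatment of \<open>k\<close> close to \<open>n\<close>. The exponent \<open>m + k\<close> has the parity
  of \<open>(n - k) / 2\<close>, the usual exponent of the sign for \<open>k \<le> n\<close>, and avoids truncated subtraction.
\<close>

lemma coeff_cheb_U:
  assumes "n + k = 2 * m"
  shows "coeff (cheb_U n :: 'a::comm_ring_1 poly) k = of_int ((-1) ^ (m + k) * 2 ^ k * int (m choose k))"
  using assms
proof (induction n arbitrary: k m rule: cheb_U.induct)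
  case 1
  then show ?case by (cases m) (auto simp: coeff_1 binomial_eq_0)
next
  case 2
  then obtain q where q: "m = Suc q" "k = Suc (2 * q)"
    by (cases m) auto
  have "coeff (cheb_U (Suc 0) :: 'a poly) k = 2 * coeff 1 (2 * q)"
    using coeff_two_X_mult[of "1 :: 'a poly" k] q by simp
  then show ?case
    using q by (cases q) (simp_all add: coeff_1 binomial_eq_0 del: cheb_U.simps)
next
  case (3 n)
  show ?case
  proof (cases k)
    case 0
    with 3(3) obtain q where q: "m = Suc q" "n + 0 = 2 * q"
      by (cases m) auto
    have "coeff (cheb_U (Suc (Suc n)) :: 'a poly) k = - coeff (cheb_U n) 0"
      by (simp only: cheb_U.simps coeff_diff coeff_two_X_mult 0) simp
    with 3(2)[OF q(2)] 0 q show ?thesis by (simp del: cheb_U.simps)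
  next
    case (Suc l)
    with 3(3) obtain q where q: "m = Suc q" "Suc n + l = 2 * q" "n + Suc l = 2 * q"
      by (cases m) auto
    have "coeff (cheb_U (Suc (Suc n)) :: 'a poly) k
        = 2 * coeff (cheb_U (Suc n)) l - coeff (cheb_U n) (Suc l)"
      by (simp only: cheb_U.simps coeff_diff coeff_two_X_mult Suc) simp
    also have "\<dots> = of_int (2 * ((-1) ^ (q + l) * 2 ^ l * int (q choose l))
        - (-1) ^ (q + Suc l) * 2 ^ Suc l * int (q choose Suc l))"
      by (simp only: 3(1)[OF q(2)] 3(2)[OF q(3)]) simp
    also have "2 * ((-1) ^ (q + l) * 2 ^ l * int (q choose l))
        - (-1) ^ (q + Suc l) * 2 ^ Suc l * int (q choose Suc l)
        = (-1) ^ (m + k) * 2 ^ k * int (m choose k)"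
      by (simp add: q Suc algebra_simps)
    finally show ?thesis .
  qed
qed

lemma coeff_cheb_T:
  assumes "k \<ge> 1"
  shows "coeff (cheb_T (k + 2 * i) :: 'a::comm_ring_1 poly) k
    = of_int ((-1) ^ i * 2 ^ (k - 1) * pyramidal k i)"
proof -
  from assms obtain l where k: "k = Suc l" by (cases k) auto
  have binom: "(k + i) choose k = (k + i) choose i" "(l + i) choose l = (l + i) choose i"
    using binomial_symmetric[of k "k + i"] binomial_symmetric[of l "l + i"] by simp_all
  have "coeff (cheb_T (k + 2 * i) :: 'a poly) k
      = coeff (cheb_U (k + 2 * i)) k - coeff (cheb_U (l + 2 * i)) l"
    by (simp add: k cheb_T_Suc_eq_cheb_U del: cheb_T.simps cheb_U.simps)
  also have "\<dots> = of_int ((-1) ^ (k + i + k) * 2 ^ k * int ((k + i) choose k)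
      - (-1) ^ (l + i + l) * 2 ^ l * int ((l + i) choose l))"
    using coeff_cheb_U[of "k + 2 * i" k "k + i", where 'a = 'a]
      coeff_cheb_U[of "l + 2 * i" l "l + i", where 'a = 'a]
    by (simp only: of_int_diff) simp
  also have "(-1) ^ (k + i + k) * 2 ^ k * int ((k + i) choose k)
      - (-1) ^ (l + i + l) * 2 ^ l * int ((l + i) choose l) = (-1) ^ i * 2 ^ (k - 1) * pyramidal k i"
    \<comment> \<open>the factor \<open>2\<close> left over from \<open>2\<^sup>k = 2 * 2\<^sup>k\<^sup>-\<^sup>1\<close> is the one in the closed form\<close>
    unfolding binom pyramidal_closed_form[OF assms]
    by (simp add: k power_add algebra_simps flip: power_mult_distrib)
  finally show ?thesis .
qed

lemma coeff_0_cheb_T_even: "coeff (cheb_T (2 * n) :: 'a::comm_ring_1 poly) 0 = (-1) ^ n"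
proof (cases n)
  case (Suc m)
  then have "coeff (cheb_T (2 * n) :: 'a poly) 0 = coeff (cheb_U (2 * n)) 0"
    by (simp add: cheb_T_Suc_eq_cheb_U del: cheb_T.simps cheb_U.simps)
  then show ?thesis
    by (simp add: coeff_cheb_U[of "2 * n" 0 n])
qed simp


section \<open>Expansions in monomials\<close>

lemma poly_eq_sum_monom_parity:
  fixes p :: "'a::comm_monoid_add poly"
  assumes "\<And>k. coeff p k \<noteq> 0 \<Longrightarrow> \<exists>j\<le>n. k = 2 * j + r"
  shows "p = (\<Sum>j = 0..n. monom (coeff p (2 * j + r)) (2 * j + r))"
proof (rule poly_eqI)
  fix k
  have *: "coeff (\<Sum>j = 0..n. monom (coeff p (2 * j + r)) (2 * j + r)) k
      = (\<Sum>j = 0..n. if 2 * j + r = k then coeff p k else 0)"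
    by (auto simp: coeff_sum intro!: sum.cong)
  show "coeff p k = coeff (\<Sum>j = 0..n. monom (coeff p (2 * j + r)) (2 * j + r)) k"
  proof (cases "\<exists>j\<le>n. k = 2 * j + r")
    case True
    then obtain i where i: "i \<le> n" "k = 2 * i + r" by blast
    then have "2 * j + r = k \<longleftrightarrow> j = i" for j by auto
    with * i show ?thesis by simp
  next
    case False
    with assms have "coeff p k = 0" by blast
    with * show ?thesis by (simp cong: if_cong)
  qed
qed

lemma cheb_U_eq_sum_monom:
  assumes "r \<le> 1"
  shows "(cheb_U (2 * n + r) :: 'a::comm_ring_1 poly)
    = (\<Sum>j = 0..n.
        monom (of_int ((-1) ^ (n + j) * 2 ^ (2 * j + r) * int ((n + j + r) choose (2 * j + r)))) (2 * j + r))"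
proof -
  have "\<exists>j\<le>n. k = 2 * j + r" if "coeff (cheb_U (2 * n + r) :: 'a poly) k \<noteq> 0" for k
    using coeff_cheb_U_nonzeroD[OF that] assms by presburger
  then have "(cheb_U (2 * n + r) :: 'a poly)
      = (\<Sum>j = 0..n. monom (coeff (cheb_U (2 * n + r)) (2 * j + r)) (2 * j + r))"
    by (rule poly_eq_sum_monom_parity)
  moreover have "coeff (cheb_U (2 * n + r) :: 'a poly) (2 * j + r)
      = of_int ((-1) ^ (n + j) * 2 ^ (2 * j + r) * int ((n + j + r) choose (2 * j + r)))" for j
  proof -
    have "(-1 :: int) ^ (n + j + r + (2 * j + r)) = (-1) ^ (n + j)"
      by (simp add: minus_one_power_iff)
    then show ?thesis
      using coeff_cheb_U[of "2 * n + r" "2 * j + r" "n + j + r", where 'a = 'a] by simp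
  qed
  ultimately show ?thesis by simp
qed

lemma cheb_T_eq_sum_monom:
  assumes "r \<le> 1"
  shows "(cheb_T (2 * n + r) :: 'a::comm_ring_1 poly)
    = (\<Sum>j = 0..n. monom (coeff (cheb_T (2 * n + r)) (2 * j + r)) (2 * j + r))"
proof (rule poly_eq_sum_monom_parity)
  fix k assume "coeff (cheb_T (2 * n + r) :: 'a poly) k \<noteq> 0"
  from coeff_cheb_T_nonzeroD[OF this] assms show "\<exists>j\<le>n. k = 2 * j + r"
    by presburger
qed

lemma coeff_cheb_T_parity:
  assumes "j \<le> n" and "2 * j + r \<ge> 1"
  shows "coeff (cheb_T (2 * n + r) :: 'a::comm_ring_1 poly) (2 * j + r)
    = of_int ((-1) ^ (n + j) * 2 ^ (2 * j + r - 1) * pyramidal (2 * j + r) (n - j))"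
proof -
  have n: "2 * n + r = 2 * j + r + 2 * (n - j)"
    using assms by simp
  have sign: "(-1 :: int) ^ (n - j) = (-1) ^ (n + j)"
    using assms by (simp add: minus_one_power_iff)
  show ?thesis
    unfolding n coeff_cheb_T[OF assms(2)] sign ..
qed

theorem theorem4p1:
  fixes n :: nat
  shows "(cheb_T (2 * n) :: 'a::comm_ring_1 poly) =
           (-1) ^ n + (\<Sum>j = 1..n.
             monom (of_int ((-1) ^ (n + j) * 2 ^ (2 * j - 1) * pyramidal (2 * j) (n - j))) (2 * j))
         \<and> (cheb_T (2 * n + 1) :: 'a poly) =
           (\<Sum>j = 0..n.
             monom (of_int ((-1) ^ (n + j) * 2 ^ (2 * j) * pyramidal (2 * j + 1) (n - j))) (2 * j + 1))
         \<and> (cheb_U (2 * n) :: 'a poly) =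
           (\<Sum>j = 0..n.
             monom (of_int ((-1) ^ (n + j) * 2 ^ (2 * j) * int ((n + j) choose (2 * j)))) (2 * j))
         \<and> (cheb_U (2 * n + 1) :: 'a poly) =
           (\<Sum>j = 0..n.
             monom (of_int ((-1) ^ (n + j) * 2 ^ (2 * j + 1) * int ((n + j + 1) choose (2 * j + 1)))) (2 * j + 1))"
proof (intro conjI)
  have "(cheb_T (2 * n) :: 'a poly) = (\<Sum>j = 0..n. monom (coeff (cheb_T (2 * n)) (2 * j)) (2 * j))"
    using cheb_T_eq_sum_monom[of 0 n] by simp
  also have "\<dots> = monom (coeff (cheb_T (2 * n)) 0) 0
      + (\<Sum>j = 1..n. monom (coeff (cheb_T (2 * n)) (2 * j)) (2 * j))"
    by (simp add: sum.atLeast_Suc_atMost)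
  also have "monom (coeff (cheb_T (2 * n)) 0) 0 = ((-1) ^ n :: 'a poly)"
    unfolding coeff_0_cheb_T_even by (simp add: monom_0 one_pCons poly_const_pow)
  also have "(\<Sum>j = 1..n. monom (coeff (cheb_T (2 * n)) (2 * j)) (2 * j)) = (\<Sum>j = 1..n.
      monom (of_int ((-1) ^ (n + j) * 2 ^ (2 * j - 1) * pyramidal (2 * j) (n - j)) :: 'a) (2 * j))"
  proof (rule sum.cong)
    fix j assume "j \<in> {1..n}"
    then show "monom (coeff (cheb_T (2 * n)) (2 * j)) (2 * j)
        = monom (of_int ((-1) ^ (n + j) * 2 ^ (2 * j - 1) * pyramidal (2 * j) (n - j)) :: 'a) (2 * j)"
      using coeff_cheb_T_parity[of j n 0, where 'a = 'a] by simp
  qed simp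
  finally show "(cheb_T (2 * n) :: 'a poly) = (-1) ^ n + (\<Sum>j = 1..n.
      monom (of_int ((-1) ^ (n + j) * 2 ^ (2 * j - 1) * pyramidal (2 * j) (n - j))) (2 * j))" .
next
  have "(cheb_T (2 * n + 1) :: 'a poly)
      = (\<Sum>j = 0..n. monom (coeff (cheb_T (2 * n + 1)) (2 * j + 1)) (2 * j + 1))"
    by (rule cheb_T_eq_sum_monom) simp
  also have "\<dots> = (\<Sum>j = 0..n.
      monom (of_int ((-1) ^ (n + j) * 2 ^ (2 * j) * pyramidal (2 * j + 1) (n - j))) (2 * j + 1))"
  proof (rule sum.cong)
    fix j assume "j \<in> {0..n}"
    then show "monom (coeff (cheb_T (2 * n + 1)) (2 * j + 1)) (2 * j + 1)
        = monom (of_int ((-1) ^ (n + j) * 2 ^ (2 * j) * pyramidal (2 * j + 1) (n - j)) :: 'a) (2 * j + 1)"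
      using coeff_cheb_T_parity[of j n 1, where 'a = 'a] by (simp del: cheb_T.simps)
  qed simp
  finally show "(cheb_T (2 * n + 1) :: 'a poly) = (\<Sum>j = 0..n.
      monom (of_int ((-1) ^ (n + j) * 2 ^ (2 * j) * pyramidal (2 * j + 1) (n - j))) (2 * j + 1))" .
next
  show "(cheb_U (2 * n) :: 'a poly) = (\<Sum>j = 0..n.
      monom (of_int ((-1) ^ (n + j) * 2 ^ (2 * j) * int ((n + j) choose (2 * j)))) (2 * j))"
    using cheb_U_eq_sum_monom[of 0 n, where 'a = 'a] by simp
next
  show "(cheb_U (2 * n + 1) :: 'a poly) = (\<Sum>j = 0..n.
      monom (of_int ((-1) ^ (n + j) * 2 ^ (2 * j + 1) * int ((n + j + 1) choose (2 * j + 1)))) (2 * j + 1))"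
    by (rule cheb_U_eq_sum_monom) simp
qed

end
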